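(* For every real $R$ with $\frac{4-\sqrt2}{2}\le R<17-9\sqrt3$ and every $\epsilon>0$, the competitive ratio of the proportional\&removable online knapsack problem with a buffer of capacity $R$ is at least $\frac{\sqrt{16R+1}-1}{2R}-\epsilon$.
   Context: Online knapsack problem with a resource buffer: there is a knapsack of capacity $1$ and a buffer of capacity $R\ge 1$. Items $e_1,\dots,e_n$ arrive one by one; each item $e$ has size $0<s(e)\le 1$ and value $v(e)\ge 0$; $s(B),v(B)$ denote sums over a set $B$. A deterministic online algorithm maintains buffer contents $B_0=\emptyset,B_1,\dots,B_n$, with $B_i$ chosen after seeing only $e_1,\dots,e_i$, $B_i\subseteq B_{i-1}\cup\{e_i\}$ and $s(B_i)\le R$ (removable setting). $\mathrm{ALG}(I)=\max\{v(B)\mid B\subseteq B_n,\ s(B)\le 1\}$, $\mathrm{OPT}(I)=\max\{v(B)\mid B\subseteq\{e_1,\dots,e_n\},\ s(B)\le 1\}$. "Proportional" means $v(e)=s(e)$ for every item. The competitive ratio of an algorithm is $\sup_I \mathrm{OPT}(I)/\mathrm{ALG}(I)$ (with $a/0=\infty$ for $a>0$), and the competitive ratio of the problem is the infimum of this over all deterministic online algorithms. *)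

theory Defs
  imports Complex_Main "HOL-Library.Extended_Real"
begin

datatype item = Item (item_size: real) (item_value: real)

(* An instance is the list e_1, ..., e_n of items in order of arrival.  Sets of items are
   represented by sets of positions (counted from 0), so that equal items stay distinct. *)
type_synonym inst = "item list"

definition instances :: "inst set" where
  "instances = {I. \<forall>e\<in>set I. 0 < item_size e \<and> item_size e \<le> 1 \<and> 0 \<le> item_value e}"

definition proportional_instances :: "inst set" where
  "proportional_instances = {I \<in> instances. \<forall>e\<in>set I. item_value e = item_size e}"

definition total_size :: "inst \<Rightarrow> nat set \<Rightarrow> real" where
  "total_size I B = (\<Sum>i\<in>B. item_size (I ! i))"

definition total_value :: "inst \<Rightarrow> nat set \<Rightarrow> real" where
  "total_value I B = (\<Sum>i\<in>B. item_value (I ! i))"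

(* The knapsack capacity is 1. *)
definition best_packing :: "inst \<Rightarrow> nat set \<Rightarrow> real" where
  "best_packing I C = Max {total_value I B | B. B \<subseteq> C \<and> total_size I B \<le> 1}"

(* A deterministic online algorithm maps each sequence e_1, ..., e_i seen so far to the buffer
   contents B_i; since it sees nothing else, B_i cannot depend on later items or on n.  The
   constraints are imposed only on the class of instances under consideration (closed under
   prefixes), which are the only inputs that occur. *)
type_synonym algorithm = "inst \<Rightarrow> nat set"

definition removable_algorithms :: "inst set \<Rightarrow> real \<Rightarrow> algorithm set" where
  "removable_algorithms \<I> R = {A. A [] = {} \<and>
     (\<forall>I e. I @ [e] \<in> \<I> \<longrightarrow>
        A (I @ [e]) \<subseteq> insert (length I) (A I) \<and>
        total_size (I @ [e]) (A (I @ [e])) \<le> R)}"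

definition ALG :: "algorithm \<Rightarrow> inst \<Rightarrow> real" where
  "ALG A I = best_packing I (A I)"

definition OPT :: "inst \<Rightarrow> real" where
  "OPT I = best_packing I {..<length I}"

(* Division on ereal satisfies a / 0 = \<infinity> for a > 0, and 0 / 0 = 0, so instances with OPT = 0
   do not affect the supremum. *)
definition algorithm_ratio :: "inst set \<Rightarrow> algorithm \<Rightarrow> ereal" where
  "algorithm_ratio \<I> A = (SUP I\<in>\<I>. ereal (OPT I) / ereal (ALG A I))"

definition competitive_ratio :: "inst set \<Rightarrow> real \<Rightarrow> ereal" where
  "competitive_ratio \<I> R = (INF A\<in>removable_algorithms \<I> R. algorithm_ratio \<I> A)"

end

theory Submission
  imports Defs
begin

text \<open>Put \<open>x = (sqrt (16 * R + 1) + 1) / 8\<close>, the reciprocal of the claimed bound, so that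
  \<open>R = 4 * x\<^sup>2 - x\<close>.  Up to perturbations of order \<open>d\<close>, the adversary presents items of sizes
  \<open>w = x\<close>, \<open>a = 2 * x - 1\<close>, \<open>m = 1 - x\<close>, again \<open>a\<close>, and \<open>c = R - 1\<close>.
  Since \<open>w + a + m > R\<close>, one of these types is dropped, and dropping \<open>w\<close> or \<open>m\<close> is punished by its
  complement to \<open>1\<close>; so both copies of \<open>a\<close> are rejected in favour of \<open>{w, m}\<close>.
  Since \<open>w + m + c > R\<close>, the arrival of \<open>c\<close> again forces a choice.  If \<open>w\<close> is dropped, then the
  buffer has value \<open>m + c = R - x = 2 * x * a\<close> while the two copies of \<open>a\<close> give \<open>2 * a\<close>.
  If \<open>m\<close> or \<open>c\<close> is dropped, then \<open>1 - m - c\<close> arrives and completes \<open>{m, c}\<close> to a full knapsack.\<close>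

definition prop_inst :: "real list \<Rightarrow> inst" where
  "prop_inst ss = map (\<lambda>s. Item s s) ss"

lemma length_prop_inst [simp]: "length (prop_inst ss) = length ss"
  by (simp add: prop_inst_def)

lemma prop_inst_append: "prop_inst (ss @ [s]) = prop_inst ss @ [Item s s]"
  by (simp add: prop_inst_def)

lemma prop_inst_proportional:
  assumes "\<forall>s\<in>set ss. 0 < s \<and> s \<le> 1"
  shows "prop_inst ss \<in> proportional_instances"
  using assms by (force simp: prop_inst_def proportional_instances_def instances_def)

lemma total_prop_inst:
  assumes "B \<subseteq> {..<length ss}"
  shows "total_size (prop_inst ss) B = (\<Sum>i\<in>B. ss ! i)"
    and "total_value (prop_inst ss) B = (\<Sum>i\<in>B. ss ! i)"
  using assms by (auto simp: total_size_def total_value_def prop_inst_def intro!: sum.cong)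

lemma finite_packings:
  "finite C \<Longrightarrow> finite {total_value I B | B. B \<subseteq> C \<and> total_size I B \<le> 1}"
  by (rule finite_subset[of _ "total_value I ` Pow C"]) auto

lemma best_packing_ge:
  assumes "finite C" "B \<subseteq> C" "total_size I B \<le> 1"
  shows "total_value I B \<le> best_packing I C"
  unfolding best_packing_def by (rule Max_ge[OF finite_packings[OF assms(1)]]) (use assms in auto)

lemma best_packing_le:
  assumes "finite C" "\<And>B. B \<subseteq> C \<Longrightarrow> total_size I B \<le> 1 \<Longrightarrow> total_value I B \<le> b"
  shows "best_packing I C \<le> b"
proof -
  have "total_value I {} \<in> {total_value I B | B. B \<subseteq> C \<and> total_size I B \<le> 1}"
    by (force simp: total_size_def)
  then show ?thesis
    unfolding best_packing_def using assms(2) finite_packings[OF assms(1)]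
    by (subst Max_le_iff) auto
qed

lemma ratio_ge:
  assumes "I \<in> \<I>" "0 < v" "v \<le> OPT I" "ALG A I \<le> q * v" "0 \<le> ALG A I" "0 < q"
  shows "ereal (1 / q) \<le> algorithm_ratio \<I> A"
proof -
  have "ereal (1 / q) \<le> ereal (OPT I) / ereal (ALG A I)"
  \<comment> \<open>If \<open>ALG\<close> vanishes, the quotient is \<infinity>, because
    \<open>OPT I\<close> is positive.\<close>
  proof (cases "ALG A I = 0")
    case True
    with assms show ?thesis by (simp add: divide_ereal_def zero_ereal_def[symmetric])
  next
    case False
    with assms have pos: "0 < ALG A I" by simp
    have "ALG A I \<le> q * OPT I"
      using assms by (meson mult_le_cancel_left_pos order_trans)
    with pos assms have "1 / q \<le> OPT I / ALG A I"
      by (simp add: field_simps)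
    with pos show ?thesis by simp
  qed
  also have "\<dots> \<le> algorithm_ratio \<I> A"
    unfolding algorithm_ratio_def using assms(1) by (rule SUP_upper)
  finally show ?thesis .
qed

text \<open>Discarding items never helps, so it suffices to test all subsets of an upper bound
  \<open>C\<close> of the buffer. The benchmark \<open>v\<close> need not be 1: the two copies of
  \<open>a\<close> will only give \<open>2 * a\<close>.\<close>

lemma prop_ratio_ge:
  assumes items: "\<forall>s\<in>set ss. 0 < s \<and> s \<le> 1"
    and buffer: "A (prop_inst ss) \<subseteq> C" "C \<subseteq> {..<length ss}"
    and q: "0 < q"
    and alg: "\<And>B. B \<subseteq> C \<Longrightarrow> (\<Sum>i\<in>B. ss ! i) \<le> q * v \<or> (\<Sum>i\<in>B. ss ! i) > 1"
    and opt: "T \<subseteq> {..<length ss}" "(\<Sum>i\<in>T. ss ! i) = v" "0 < v" "v \<le> 1"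
  shows "ereal (1 / q) \<le> algorithm_ratio proportional_instances A"
proof (rule ratio_ge[OF prop_inst_proportional[OF items] \<open>0 < v\<close> _ _ _ q])
  have fin: "finite (A (prop_inst ss))"
    using buffer by (meson finite_lessThan finite_subset)
  show "v \<le> OPT (prop_inst ss)"
    using best_packing_ge[of "{..<length ss}" T "prop_inst ss"] opt
    by (simp add: OPT_def total_prop_inst)
  show "ALG A (prop_inst ss) \<le> q * v"
    unfolding ALG_def
  proof (rule best_packing_le[OF fin])
    fix B assume B: "B \<subseteq> A (prop_inst ss)" "total_size (prop_inst ss) B \<le> 1"
    then have "B \<subseteq> C" "B \<subseteq> {..<length ss}" using buffer by auto
    with B(2) alg[of B] show "total_value (prop_inst ss) B \<le> q * v"
      by (simp add: total_prop_inst)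
  qed
  show "0 \<le> ALG A (prop_inst ss)"
    using best_packing_ge[OF fin, of "{}" "prop_inst ss"]
    by (simp add: ALG_def total_size_def total_value_def)
qed

lemma subset_pair_cases:
  assumes "B \<subseteq> {i, j}"
  obtains "B = {}" | "B = {i}" | "B = {j}" | "B = {i, j}"
  using assms by blast

lemma subset_triple_cases:
  assumes "B \<subseteq> {i, j, k}"
  obtains "B \<subseteq> {j, k}" | "B \<subseteq> {i, k}" | "B \<subseteq> {i, j}" | "B = {i, j, k}"
  using assms by blast

lemma removable_step:
  assumes "A \<in> removable_algorithms proportional_instances R"
    and "\<forall>t\<in>set (ss @ [s]). 0 < t \<and> t \<le> 1"
  shows "A (prop_inst (ss @ [s])) \<subseteq> insert (length ss) (A (prop_inst ss))"
    and "total_size (prop_inst (ss @ [s])) (A (prop_inst (ss @ [s]))) \<le> R"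
  using assms(1) prop_inst_proportional[OF assms(2)]
  by (fastforce simp: removable_algorithms_def prop_inst_append)+

text \<open>Three items exceed the buffer, so at least one is missing. The outcomes are inclusions
  in order to cover algorithms that discard more than they must.\<close>

lemma forced_drop:
  assumes A: "A \<in> removable_algorithms proportional_instances R"
    and items: "\<forall>t\<in>set (ss @ [s]). 0 < t \<and> t \<le> 1"
    and old: "A (prop_inst ss) \<subseteq> {i, j}" "i < length ss" "j < length ss" "i \<noteq> j"
    and big: "ss ! i + ss ! j + s > R"
  obtains "A (prop_inst (ss @ [s])) \<subseteq> {j, length ss}"
    | "A (prop_inst (ss @ [s])) \<subseteq> {i, length ss}"
    | "A (prop_inst (ss @ [s])) \<subseteq> {i, j}"
proof -
  have "A (prop_inst (ss @ [s])) \<subseteq> {i, j, length ss}"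
    using removable_step(1)[OF A items] old(1) by blast
  moreover have "A (prop_inst (ss @ [s])) \<noteq> {i, j, length ss}"
  proof
    assume eq: "A (prop_inst (ss @ [s])) = {i, j, length ss}"
    have "total_size (prop_inst (ss @ [s])) {i, j, length ss} = ss ! i + ss ! j + s"
      using old by (subst total_prop_inst) (auto simp: nth_append)
    with removable_step(2)[OF A items] eq big show False by simp
  qed
  ultimately show thesis using that by (elim subset_triple_cases) auto
qed

text \<open>The last item \<open>y\<close> completes \<open>T\<close> to an exactly full knapsack,
  so \<open>OPT\<close> is 1. Even with \<open>i\<close>, \<open>j\<close> and \<open>y\<close> all
  in the buffer, each single item or pair has value at most \<open>q\<close> or overflows, and the
  triple overflows.\<close>

lemma final_item:
  assumes A: "A \<in> removable_algorithms proportional_instances R"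
    and items: "\<forall>t\<in>set (ss @ [y]). 0 < t \<and> t \<le> 1"
    and old: "A (prop_inst ss) \<subseteq> {i, j}" "i < length ss" "j < length ss" "i \<noteq> j"
    and q: "0 < q" "ss ! i \<le> q" "ss ! j \<le> q" "y \<le> q"
    and pairs: "ss ! i + ss ! j \<le> q \<or> ss ! i + ss ! j > 1"
      "ss ! i + y \<le> q \<or> ss ! i + y > 1" "ss ! j + y \<le> q \<or> ss ! j + y > 1"
    and all: "ss ! i + ss ! j + y > 1"
    and opt: "T \<subseteq> {..<length ss}" "(\<Sum>i\<in>T. ss ! i) + y = 1"
  shows "ereal (1 / q) \<le> algorithm_ratio proportional_instances A"
proof (rule prop_ratio_ge[where ss = "ss @ [y]" and C = "{i, j, length ss}" and v = 1
      and T = "insert (length ss) T"])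
  show "A (prop_inst (ss @ [y])) \<subseteq> {i, j, length ss}"
    using removable_step(1)[OF A items] old(1) by blast
  have "(\<Sum>k\<in>T. (ss @ [y]) ! k) = (\<Sum>k\<in>T. ss ! k)"
    using opt(1) by (intro sum.cong) (auto simp: nth_append)
  moreover have "finite T" "length ss \<notin> T"
    using opt(1) by (auto intro: finite_subset)
  ultimately show "(\<Sum>k\<in>insert (length ss) T. (ss @ [y]) ! k) = 1"
    using opt(2) by simp
  fix B assume "B \<subseteq> {i, j, length ss}"
  then show "(\<Sum>k\<in>B. (ss @ [y]) ! k) \<le> q * 1 \<or> (\<Sum>k\<in>B. (ss @ [y]) ! k) > 1"
    using old q pairs all
    by (elim subset_triple_cases; (elim subset_pair_cases)?) (auto simp: nth_append)
qed (use items old q opt in auto)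

lemma adversary_ratio:
  fixes x d R :: real
  assumes A: "A \<in> removable_algorithms proportional_instances R"
    and R: "R = 4 * x\<^sup>2 - x" and x: "7 / 10 \<le> x" "x \<le> 74 / 100" "2 - x \<le> R"
    and d: "0 < d" "d \<le> 1 / 1000"
  shows "ereal (1 / (x + 5 * d)) \<le> algorithm_ratio proportional_instances A"
proof -
  \<comment> \<open>The perturbations turn ties into overflows: \<open>w + m = 1 + d\<close> exceeds
    the knapsack and \<open>w + m + c = R + 3 * d\<close> the buffer. The slack \<open>5 * d\<close>
    in \<open>q\<close> absorbs the resulting errors.\<close>
  define w a m c q where "w = x - d" and "a = 2 * x - 1" and "m = 1 - x + 2 * d"
    and "c = R - 1 + 2 * d" and "q = x + 5 * d"
  note defs = w_def a_def m_def c_def q_def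
  \<comment> \<open>Here \<open>2 * x - R = x * (3 - 4 * x)\<close>. The bound yields
    \<open>w + a + m = 2 * x + d > R\<close>; the term \<open>5 * d\<close> is what
    \<open>w + (1 - m - c) > 1\<close> requires.\<close>
  have R_less: "R < 2 * x - 5 * d"
  proof -
    have "7 / 10 * (4 / 100) \<le> x * (3 - 4 * x)"
      using x by (intro mult_mono) auto
    then show ?thesis using R d by (simp add: power2_eq_square algebra_simps)
  qed
  have items: "0 < w" "w \<le> 1" "0 < a" "a \<le> 1" "0 < m" "m \<le> 1" "0 < c" "c \<le> 1"
    using x d R_less by (auto simp: defs)
  \<comment> \<open>With \<open>y = 1 - w\<close>: \<open>a + m = x + 2 * d\<close>,
    \<open>a + y = x + d\<close> and \<open>m + y = 2 - 2 * x + 3 * d\<close> are at most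
    \<open>q\<close>, while \<open>a + m + y = 1 + 3 * d\<close>.\<close>
  have drop_w: "ereal (1 / q) \<le> algorithm_ratio proportional_instances A"
    if "A (prop_inst ss) \<subseteq> {i, 2}" "ss = [w, a, m] \<and> i = 1 \<or> ss = [w, a, m, a] \<and> i = 3" for ss i
    by (rule final_item[OF A, where ss = ss and y = "1 - w" and i = i and j = 2 and T = "{0}"])
      (use that items x d R_less in \<open>auto simp: defs\<close>)
  \<comment> \<open>Any two of \<open>w\<close>, \<open>a\<close> and \<open>1 - m\<close> overflow
    the knapsack.\<close>
  have drop_m: "ereal (1 / q) \<le> algorithm_ratio proportional_instances A"
    if "A (prop_inst ss) \<subseteq> {0, i}" "ss = [w, a, m] \<and> i = 1 \<or> ss = [w, a, m, a] \<and> i = 3" for ss i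
    by (rule final_item[OF A, where ss = ss and y = "1 - m" and i = 0 and j = i and T = "{2}"])
      (use that items x d R_less in \<open>auto simp: defs\<close>)
  \<comment> \<open>With \<open>y = 1 - m - c\<close>, \<open>w\<close> overflows with each of
    \<open>m\<close>, \<open>c\<close> and \<open>y\<close>. The assumption
    \<open>2 - x \<le> R\<close> enters twice: \<open>w + c = x + R - 1 + d > 1\<close> and
    \<open>m + y = 1 - c < x\<close>.\<close>
  have keep_w: "ereal (1 / q) \<le> algorithm_ratio proportional_instances A"
    if "A (prop_inst [w, a, m, a, c]) \<subseteq> {0, i}" "i = 2 \<or> i = 4" for i
    by (rule final_item[OF A, where ss = "[w, a, m, a, c]" and y = "1 - m - c"
          and i = 0 and j = i and T = "{2, 4}"])
      (use that items x d R_less in \<open>auto simp: defs\<close>)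
  have keep_mc: "ereal (1 / q) \<le> algorithm_ratio proportional_instances A"
    if "A (prop_inst [w, a, m, a, c]) \<subseteq> {2, 4}"
  proof -
    \<comment> \<open>This is exactly \<open>q * (2 * a) - (m + c)\<close>, as
      \<open>R - x = 2 * x * a\<close>. With slack \<open>5 * d\<close> in \<open>q\<close> it needs
      \<open>a \<ge> 4 / 10\<close>, that is \<open>x \<ge> 7 / 10\<close>.\<close>
    have "0 \<le> (10 * a - 4) * d" using x d by (simp add: a_def)
    then have "m + c \<le> q * (2 * a)"
      by (simp add: defs R power2_eq_square algebra_simps)
    with items have bound: "m \<le> q * (2 * a)" "c \<le> q * (2 * a)" "m + c \<le> q * (2 * a)"
      "0 \<le> q * (2 * a)" by linarith+
    show ?thesis
    proof (rule prop_ratio_ge[where ss = "[w, a, m, a, c]" and C = "{2, 4}" and v = "2 * a"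
          and T = "{1, 3}"])
      fix B :: "nat set" assume "B \<subseteq> {2, 4}"
      then show "(\<Sum>k\<in>B. [w, a, m, a, c] ! k) \<le> q * (2 * a) \<or> (\<Sum>k\<in>B. [w, a, m, a, c] ! k) > 1"
        using bound items by (elim subset_pair_cases) auto
    qed (use that items x d in \<open>auto simp: a_def q_def\<close>)
  qed
  have "A (prop_inst []) = {}"
    using A by (simp add: removable_algorithms_def prop_inst_def)
  then have "A (prop_inst [w]) \<subseteq> {0}"
    using removable_step(1)[OF A, of "[]" w] items by simp
  then have start: "A (prop_inst [w, a]) \<subseteq> {0, 1}"
    using removable_step(1)[OF A, of "[w]" a] items by auto
  have choice3: "A (prop_inst [w, a, m]) \<subseteq> {1, 2} \<or> A (prop_inst [w, a, m]) \<subseteq> {0, 2}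
      \<or> A (prop_inst [w, a, m]) \<subseteq> {0, 1}"
    by (rule forced_drop[OF A, where ss = "[w, a]" and s = m, OF _ start])
      (use items x d R_less in \<open>auto simp: defs numeral_2_eq_2\<close>)
  have choice4: "A (prop_inst [w, a, m, a]) \<subseteq> {2, 3} \<or> A (prop_inst [w, a, m, a]) \<subseteq> {0, 3}
      \<or> A (prop_inst [w, a, m, a]) \<subseteq> {0, 2}" if "A (prop_inst [w, a, m]) \<subseteq> {0, 2}"
    by (rule forced_drop[OF A, where ss = "[w, a, m]" and s = a, OF _ that])
      (use items x d R_less in \<open>auto simp: defs numeral_3_eq_3\<close>)
  have choice5: "A (prop_inst [w, a, m, a, c]) \<subseteq> {2, 4} \<or> A (prop_inst [w, a, m, a, c]) \<subseteq> {0, 4}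
      \<or> A (prop_inst [w, a, m, a, c]) \<subseteq> {0, 2}" if "A (prop_inst [w, a, m, a]) \<subseteq> {0, 2}"
    by (rule forced_drop[OF A, where ss = "[w, a, m, a]" and s = c, OF _ that])
      (use items x d R_less in \<open>auto simp: defs\<close>)
  show ?thesis
    using choice3 choice4 choice5 drop_w drop_m keep_w keep_mc
    unfolding q_def[symmetric] by (metis insert_commute)
qed

theorem theorem13:
  fixes R \<epsilon> :: real
  assumes "(4 - sqrt 2) / 2 \<le> R" and "R < 17 - 9 * sqrt 3" and "\<epsilon> > 0"
  shows "competitive_ratio proportional_instances R
           \<ge> ereal ((sqrt (16 * R + 1) - 1) / (2 * R) - \<epsilon>)"
proof -
  \<comment> \<open>The loss \<open>1 / x - 1 / (x + 5 * d) = 5 * d / (x * (x + 5 * d))\<close> is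
    at most \<open>20 * d\<close>, since the denominator exceeds \<open>1 / 4\<close>.\<close>
  define s x d where "s = sqrt (16 * R + 1)" and "x = (s + 1) / 8" and "d = min (\<epsilon> / 20) (1 / 1000)"
  have sqrt2: "sqrt 2 \<le> 142 / 100" by (rule real_le_lsqrt) (auto simp: power2_eq_square)
  have sqrt3: "173 / 100 \<le> sqrt 3" by (rule real_le_rsqrt) (auto simp: power2_eq_square)
  have R_bounds: "129 / 100 \<le> R" "R \<le> 143 / 100" using assms sqrt2 sqrt3 by auto
  have s2: "s\<^sup>2 = 16 * R + 1" using R_bounds by (simp add: s_def)
  have R: "R = 4 * x\<^sup>2 - x"
    using s2 by (simp add: x_def power2_eq_square field_simps)
  \<comment> \<open>Equality holds at the lower endpoint of the range of \<open>R\<close>, where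
    \<open>x = sqrt 2 / 2\<close> and \<open>R = 2 - x\<close>.\<close>
  have s_lower: "4 * sqrt 2 - 1 \<le> s"
    unfolding s_def using assms(1) by (intro real_le_rsqrt) (simp add: power2_diff power_mult_distrib)
  then have x_lower: "sqrt 2 / 2 \<le> x" by (simp add: x_def)
  have "141 / 100 \<le> sqrt 2" by (rule real_le_rsqrt) (auto simp: power2_eq_square)
  with x_lower have "7 / 10 \<le> x" by simp
  \<comment> \<open>Staying below \<open>3 / 4\<close> keeps \<open>3 - 4 * x\<close> positive,
    hence \<open>R < 2 * x\<close>.\<close>
  moreover have "x \<le> 74 / 100"
  proof -
    have "s \<le> 492 / 100"
      unfolding s_def using R_bounds by (intro real_le_lsqrt) (auto simp: power2_eq_square)
    then show ?thesis by (simp add: x_def)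
  qed
  moreover have "2 - x \<le> R" using assms(1) x_lower by simp
  moreover have d: "0 < d" "d \<le> 1 / 1000" "20 * d \<le> \<epsilon>" using assms(3) by (auto simp: d_def)
  ultimately have bound: "ereal (1 / (x + 5 * d)) \<le> competitive_ratio proportional_instances R"
    unfolding competitive_ratio_def using adversary_ratio[OF _ R] by (intro INF_greatest) auto
  have "(s - 1) / (2 * R) = 1 / x"
  proof -
    have "(s - 1) * x = 2 * R" using s2 by (simp add: x_def power2_eq_square field_simps)
    then show ?thesis using R_bounds \<open>7 / 10 \<le> x\<close> by (simp add: field_simps)
  qed
  moreover have "1 / x - \<epsilon> \<le> 1 / (x + 5 * d)"
  proof -
    have "7 / 10 * (7 / 10) \<le> x * (x + 5 * d)"
      using \<open>7 / 10 \<le> x\<close> d by (intro mult_mono) auto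
    then have "\<epsilon> * (1 / 4) \<le> \<epsilon> * (x * (x + 5 * d))"
      using assms(3) by (intro mult_left_mono) auto
    then have "5 * d \<le> \<epsilon> * (x * (x + 5 * d))" using d by linarith
    then show ?thesis using \<open>7 / 10 \<le> x\<close> d by (simp add: field_simps)
  qed
  ultimately have "ereal ((s - 1) / (2 * R) - \<epsilon>) \<le> ereal (1 / (x + 5 * d))" by simp
  then show ?thesis using bound unfolding s_def by (rule order_trans)
qed

end
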